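(* Let $F=\frac1n\sum_{i=1}^nF_i$, where each $F_i:\mathbb{R}^d\to\mathbb{R}^d$ is $L_i$-Lipschitz ($L_i>0$) and satisfies $\langle F_i(x)-F_i(x^* ),x-x^*\rangle\ge\mu_i\|x-x^*\|^2$ for all $x$, with (possibly negative) $\mu_i\in\mathbb{R}$, $|\mu_i|\le L_i$. Assume $\overline\mu=\frac1n\sum_{i:\mu_i\ge0}\mu_i+\frac4n\sum_{i:\mu_i<0}\mu_i\ge0$. Let $\xi^k$ be sampled from $\{1,\dots,n\}$ with $\mathbb{P}[\xi^k=i]=L_i/\sum_{j=1}^nL_j$, let $\overline L=\frac1n\sum_{i=1}^nL_i$, $\gamma_{1,\xi^k}=\gamma\overline L/L_{\xi^k}$ with $0<\gamma\le\frac{1}{6\overline L}$, and $\gamma_{2,\xi^k}=\alpha\gamma_{1,\xi^k}$ with $0<\alpha<1$. Let $\sigma_{IS*}^2=\frac1n\sum_{i=1}^n\frac{\overline L}{L_i}\|F_i(x^* )\|^2$. Then $g^k=F_{\xi^k}(x^k-\gamma_{1,\xi^k}F_{\xi^k}(x^k))$, with stepsize $\gamma_{2,\xi^k}$, satisfies the unified assumption (see context) with $$A=2\alpha,\quad C=0,\quad D_1=6\alpha^2\gamma^2\sigma_{IS*}^2,\quad\rho=\frac{\alpha\gamma\overline\mu}{2},$$ $$G_k=\frac{\alpha\gamma^2}{n}\sum_{i=1}^n\frac{\overline L}{L_i}\left(1-4\frac{|\mu_i|}{L_i}\overline L\gamma-2\overline L^2\gamma^2\right)\|F_i(x^k)\|^2,\quad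 B=\frac12,\quad D_2=\frac{3\alpha\gamma^2}{2}\sigma_{IS*}^2.$$ If additionally $\alpha\le\frac14$, then for all $K\ge0$: in the case $\overline\mu>0$, $$\mathbb{E}\left[\|x^{K+1}-x^*\|^2\right]\le\left(1-\frac{\alpha\gamma\overline\mu}{2}\right)\mathbb{E}\left[\|x^K-x^*\|^2\right]+\frac{3\alpha}{2}(4\alpha+1)\gamma^2\sigma_{IS*}^2,$$ $$\mathbb{E}\left[\|x^K-x^*\|^2\right]\le\left(1-\frac{\alpha\gamma\overline\mu}{2}\right)^K\|x^0-x^*\|^2+\frac{3(4\alpha+1)\gamma\sigma_{IS*}^2}{\overline\mu};$$ and in the case $\overline\mu=0$, $$\frac{1}{K+1}\sum_{k=0}^K\mathbb{E}\left[\frac1n\sum_{i=1}^n\frac{\overline L}{L_i}\left(1-4\frac{|\mu_i|}{L_i}\overline L\gamma-2\overline L^2\gamma^2\right)\|F_i(x^k)\|^2\right]\le\frac{2\|x^0-x^*\|^2}{\alpha\gamma^2(K+1)}+3(4\alpha+1)\sigma_{IS*}^2.$$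
   Context: $x^*\in\mathbb{R}^d$ satisfies $F(x^* )=0$, $\|\cdot\|$ is the Euclidean norm. The samples $\xi^0,\xi^1,\dots$ are independent; $\mathbb{E}_{\xi^k}$ is the expectation over $\xi^k$ only (conditional on $x^k$). Same-sample stochastic extragradient (S-SEG), started at a deterministic $x^0$, is $x^{k+1}=x^k-\gamma_{2,\xi^k}F_{\xi^k}(x^k-\gamma_{1,\xi^k}F_{\xi^k}(x^k))$, $k\ge0$. Unified assumption for a method $x^{k+1}=x^k-\gamma_{\xi^k}g^k$ with parameters $A,B,C,D_1,D_2\ge0$, $\rho\in[0,1]$ and non-negative $G_k$: with $P_k=\mathbb{E}_{\xi^k}[\gamma_{\xi^k}\langle g^k,x^k-x^*\rangle]$, for all $k\ge 0$, $$\mathbb{E}_{\xi^k}[\gamma_{\xi^k}^2\|g^k\|^2]\le2AP_k+C\|x^k-x^*\|^2+D_1,\qquad P_k\ge\rho\|x^k-x^*\|^2+BG_k-D_2.$$ Here $\gamma_{\xi^k}=\gamma_{2,\xi^k}$. *)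

theory Defs
  imports "HOL-Probability.Probability"
begin

definition mean_operator :: "nat \<Rightarrow> (nat \<Rightarrow> 'a \<Rightarrow> 'a) \<Rightarrow> 'a \<Rightarrow> 'a::real_vector"
  where "mean_operator n F x = (1 / real n) *\<^sub>R (\<Sum>i=1..n. F i x)"

definition mean_real :: "nat \<Rightarrow> (nat \<Rightarrow> real) \<Rightarrow> real"
  where "mean_real n L = (1 / real n) * (\<Sum>i=1..n. L i)"

definition mu_bar :: "nat \<Rightarrow> (nat \<Rightarrow> real) \<Rightarrow> real"
  where "mu_bar n \<mu> =
    (1 / real n) * (\<Sum>i | i \<in> {1..n} \<and> \<mu> i \<ge> 0. \<mu> i) +
    (4 / real n) * (\<Sum>i | i \<in> {1..n} \<and> \<mu> i < 0. \<mu> i)"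

definition sigma_IS_sq ::
    "nat \<Rightarrow> (nat \<Rightarrow> 'a \<Rightarrow> 'a::real_normed_vector) \<Rightarrow> (nat \<Rightarrow> real) \<Rightarrow> 'a \<Rightarrow> real"
  where "sigma_IS_sq n F L xs =
    (1 / real n) * (\<Sum>i=1..n. mean_real n L / L i * (norm (F i xs))\<^sup>2)"

definition weighted_residual ::
    "nat \<Rightarrow> (nat \<Rightarrow> 'a \<Rightarrow> 'a::real_normed_vector) \<Rightarrow> (nat \<Rightarrow> real) \<Rightarrow> (nat \<Rightarrow> real) \<Rightarrow> real \<Rightarrow> 'a \<Rightarrow> real"
  where "weighted_residual n F L \<mu> \<gamma> x =
    (1 / real n) * (\<Sum>i=1..n. mean_real n L / L i *
      (1 - 4 * (\<bar>\<mu> i\<bar> / L i) * mean_real n L * \<gamma> - 2 * (mean_real n L)\<^sup>2 * \<gamma>\<^sup>2) *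
      (norm (F i x))\<^sup>2)"

definition seg_direction :: "('i \<Rightarrow> 'a \<Rightarrow> 'a) \<Rightarrow> ('i \<Rightarrow> real) \<Rightarrow> 'i \<Rightarrow> 'a \<Rightarrow> 'a::real_vector"
  where "seg_direction F \<gamma>1 i x = F i (x - \<gamma>1 i *\<^sub>R F i x)"

primrec s_seg ::
    "('i \<Rightarrow> 'a \<Rightarrow> 'a) \<Rightarrow> ('i \<Rightarrow> real) \<Rightarrow> ('i \<Rightarrow> real) \<Rightarrow> 'a \<Rightarrow> (nat \<Rightarrow> 'i) \<Rightarrow> nat \<Rightarrow> 'a::real_vector"
  where
    "s_seg F \<gamma>1 \<gamma>2 x0 \<xi> 0 = x0"
  | "s_seg F \<gamma>1 \<gamma>2 x0 \<xi> (Suc k) =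
      s_seg F \<gamma>1 \<gamma>2 x0 \<xi> k -
      \<gamma>2 (\<xi> k) *\<^sub>R seg_direction F \<gamma>1 (\<xi> k) (s_seg F \<gamma>1 \<gamma>2 x0 \<xi> k)"

definition cond_exp_given :: "'s measure \<Rightarrow> ('s \<Rightarrow> 'a::topological_space) \<Rightarrow> ('s \<Rightarrow> real) \<Rightarrow> 's \<Rightarrow> real"
  where "cond_exp_given M X Y = real_cond_exp M (vimage_algebra (space M) X borel) Y"

text \<open>The expectation over the \<open>k\<close>-th sample is the conditional expectation given the \<open>k\<close>-th
  iterate, so the two inequalities are required almost surely. The measurability and
  integrability clauses say that these conditional expectations are meaningful:
  \<^const>\<open>real_cond_exp\<close> is total and carries no information for non-integrable arguments.\<close>

definition unified_assumption ::
    "'s measure \<Rightarrow> 'a::euclidean_space \<Rightarrow> (nat \<Rightarrow> 's \<Rightarrow> 'a) \<Rightarrow> (nat \<Rightarrow> 's \<Rightarrow> real) \<Rightarrow> (nat \<Rightarrow> 's \<Rightarrow> 'a) \<Rightarrow>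
     real \<Rightarrow> real \<Rightarrow> real \<Rightarrow> real \<Rightarrow> real \<Rightarrow> real \<Rightarrow> (nat \<Rightarrow> 's \<Rightarrow> real) \<Rightarrow> bool"
  where "unified_assumption M xs x step g A B C D1 D2 \<rho> G \<longleftrightarrow>
    0 \<le> A \<and> 0 \<le> B \<and> 0 \<le> C \<and> 0 \<le> D1 \<and> 0 \<le> D2 \<and> 0 \<le> \<rho> \<and> \<rho> \<le> 1 \<and>
    (\<forall>k. \<forall>\<omega>\<in>space M. 0 \<le> G k \<omega>) \<and>
    (\<forall>k. \<forall>\<omega>\<in>space M. x (Suc k) \<omega> = x k \<omega> - step k \<omega> *\<^sub>R g k \<omega>) \<and>
    (\<forall>k. x k \<in> borel_measurable M \<and>
      integrable M (\<lambda>\<omega>. (step k \<omega>)\<^sup>2 * (norm (g k \<omega>))\<^sup>2) \<and>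
      integrable M (\<lambda>\<omega>. step k \<omega> * (g k \<omega> \<bullet> (x k \<omega> - xs)))) \<and>
    (\<forall>k. let P = cond_exp_given M (x k) (\<lambda>\<omega>. step k \<omega> * (g k \<omega> \<bullet> (x k \<omega> - xs)))
      in AE \<omega> in M.
        cond_exp_given M (x k) (\<lambda>\<omega>. (step k \<omega>)\<^sup>2 * (norm (g k \<omega>))\<^sup>2) \<omega>
          \<le> 2 * A * P \<omega> + C * (norm (x k \<omega> - xs))\<^sup>2 + D1 \<and>
        P \<omega> \<ge> \<rho> * (norm (x k \<omega> - xs))\<^sup>2 + B * G k \<omega> - D2)"

end

theory Submission
  imports Defs
begin

text \<open>
  Everything rests on one deterministic inequality for a single operator \<open>f\<close> with extrapolated
  value \<open>g = f (x - s *\<^sub>R f x)\<close>, lemma \<open>extragradient_step_lower\<close>: the inner product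
  \<open>(g - f xs) \<bullet> (x - xs)\<close> is bounded below by a multiple of \<open>(norm (x - xs))\<^sup>2\<close>, plus positive
  multiples of \<open>(norm g)\<^sup>2\<close> and \<open>(norm (f x))\<^sup>2\<close>, minus the cross term \<open>f xs \<bullet> f x\<close>. As
  \<open>s * L \<le> 1 / 6\<close>, the two squares absorb the cross term at the price of a multiple of
  \<open>(norm (f xs))\<^sup>2\<close>, the noise. Distributing the squares in three ways gives the second-moment
  bound, the lower bound on the inner product, and the decrease of the distance to \<open>xs\<close>.

  Importance sampling then matches the stepsizes: probability times extrapolation stepsize is
  \<open>\<gamma> / n\<close> for every index. Hence the weighted averages of the three inequalities involve exactly \<^const>\<open>mu_bar\<close>,
  \<^const>\<open>sigma_IS_sq\<close> and \<^const>\<open>weighted_residual\<close>, and the centring terms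
  \<open>F i xs \<bullet> (x - xs)\<close> cancel because the mean operator vanishes at \<open>xs\<close> (\<open>avg_second_moment\<close>,
  \<open>avg_progress\<close>, \<open>avg_descent\<close>). Sample \<open>k\<close> is independent of iterate \<open>k\<close>, so these averages are
  the conditional expectations in the unified assumption (\<open>cond_exp_independent_sample\<close>).

  The convergence rates follow by iterating the averaged decrease. They are not deduced from the
  unified assumption: for \<open>\<alpha> < 1 / 4\<close> that deduction would give a larger noise constant than the
  one claimed, since the conditional inner product can be negative (see \<open>sample_descent\<close>).
\<close>

section \<open>One extragradient step with a single operator\<close>

text \<open>Discriminant criterion. It disposes of every cross term between \<open>f x\<close> and \<open>f xs\<close> below.\<close>

lemma quadratic_form_nonneg:
  fixes u v :: "'a::real_inner"
  assumes "0 \<le> p" "0 \<le> q" "r\<^sup>2 \<le> p * q"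
  shows "0 \<le> p * (norm u)\<^sup>2 - 2 * r * (u \<bullet> v) + q * (norm v)\<^sup>2"
proof (cases "p = 0")
  case True
  then have "r = 0" using assms by simp
  with True assms show ?thesis by simp
next
  case False
  then have p: "p > 0" using assms by simp
  have "0 \<le> (norm (p *\<^sub>R u - r *\<^sub>R v))\<^sup>2" by simp
  also have "\<dots> = p\<^sup>2 * (norm u)\<^sup>2 - 2 * p * r * (u \<bullet> v) + r\<^sup>2 * (norm v)\<^sup>2"
    unfolding power2_norm_eq_inner
    by (simp add: inner_diff_left inner_diff_right inner_commute power2_eq_square algebra_simps)
  also have "\<dots> \<le> p\<^sup>2 * (norm u)\<^sup>2 - 2 * p * r * (u \<bullet> v) + (p * q) * (norm v)\<^sup>2"
    using assms by (intro add_left_mono mult_right_mono) auto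
  also have "\<dots> = p * (p * (norm u)\<^sup>2 - 2 * r * (u \<bullet> v) + q * (norm v)\<^sup>2)"
    by (simp add: power2_eq_square algebra_simps)
  finally show ?thesis using p by (simp add: zero_le_mult_iff)
qed

text \<open>The operator is monotone with modulus \<open>\<mu>\<close> at the extrapolated point, whereas the estimates are
  about the current one. Moving the base point halves a nonnegative modulus and doubles a negative
  one. This ratio of four is the origin of the factor 4 in \<^const>\<open>mu_bar\<close>.\<close>

definition shifted_modulus :: "real \<Rightarrow> real" where
  "shifted_modulus \<mu> = (if \<mu> \<ge> 0 then \<mu> / 2 else 2 * \<mu>)"

lemma norm_diff_sq_le:
  fixes u v :: "'a::real_inner"
  shows "(norm (u - v))\<^sup>2 \<le> 2 * (norm u)\<^sup>2 + 2 * (norm v)\<^sup>2"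
  using zero_le_power2[of "norm (u + v)"]
  unfolding power2_norm_eq_inner
  by (simp add: inner_diff_left inner_diff_right inner_add_left inner_add_right inner_commute)

lemma shifted_modulus_shift:
  fixes z v :: "'a::real_inner"
  shows "\<mu> * (norm (z - v))\<^sup>2 \<ge> shifted_modulus \<mu> * (norm z)\<^sup>2 - 2 * \<bar>\<mu>\<bar> * (norm v)\<^sup>2"
proof (cases "\<mu> \<ge> 0")
  case True
  have "(norm z)\<^sup>2 \<le> 2 * (norm (z - v))\<^sup>2 + 2 * (norm v)\<^sup>2"
    using norm_diff_sq_le[of "z - v" "- v"] by simp
  then have "\<mu> / 2 * (norm z)\<^sup>2 \<le> \<mu> / 2 * (2 * (norm (z - v))\<^sup>2 + 4 * (norm v)\<^sup>2)"
    using True by (intro mult_left_mono) (auto intro: order_trans)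
  then show ?thesis using True by (simp add: shifted_modulus_def algebra_simps)
next
  case False
  then have "\<mu> * (2 * (norm z)\<^sup>2 + 2 * (norm v)\<^sup>2) \<le> \<mu> * (norm (z - v))\<^sup>2"
    using norm_diff_sq_le[of z v] by (intro mult_left_mono_neg) auto
  then show ?thesis using False by (simp add: shifted_modulus_def algebra_simps)
qed

text \<open>The common source of all estimates. Split \<open>x - xs\<close> at the extrapolated point
  \<open>y = x - s *\<^sub>R f x\<close>: the part \<open>y - xs\<close> is controlled by monotonicity, and the part
  \<open>s *\<^sub>R f x\<close> contributes \<open>g \<bullet> f x\<close>, which by polarization equals half the sum of the two squares
  up to \<open>norm (g - f x)\<close>, a quantity that the Lipschitz condition makes small. The operator is
  centred at \<open>f xs\<close>, since an individual operator need not vanish at the solution.\<close>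

lemma extragradient_step_lower:
  fixes f :: "'a::real_inner \<Rightarrow> 'a" and x :: 'a
  assumes lip: "L-lipschitz_on UNIV f" and s: "0 \<le> s"
    and mono: "\<And>y. (f y - f xs) \<bullet> (y - xs) \<ge> \<mu> * (norm (y - xs))\<^sup>2"
  defines "g \<equiv> f (x - s *\<^sub>R f x)"
  shows "s * ((g - f xs) \<bullet> (x - xs)) \<ge> s * shifted_modulus \<mu> * (norm (x - xs))\<^sup>2
     + s\<^sup>2 * (1/2 * (norm g)\<^sup>2 + (1/2 * (1 - (s * L)\<^sup>2) - 2 * \<bar>\<mu>\<bar> * s) * (norm (f x))\<^sup>2 - f xs \<bullet> f x)"
proof -
  let ?y = "x - s *\<^sub>R f x"
  have dist: "(norm (g - f x))\<^sup>2 \<le> (s * L)\<^sup>2 * (norm (f x))\<^sup>2"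
  proof -
    have "norm (g - f x) \<le> L * norm (s *\<^sub>R f x)"
      using lipschitz_onD[OF lip, of ?y x] by (simp add: g_def dist_norm)
    also have "\<dots> = s * L * norm (f x)" using s by simp
    finally have "(norm (g - f x))\<^sup>2 \<le> (s * L * norm (f x))\<^sup>2" by (simp add: power_mono)
    then show ?thesis by (simp add: power_mult_distrib)
  qed
  have "(g - f xs) \<bullet> (?y - xs) \<ge> shifted_modulus \<mu> * (norm (x - xs))\<^sup>2 - 2 * \<bar>\<mu>\<bar> * (norm (s *\<^sub>R f x))\<^sup>2"
    using mono[of ?y] shifted_modulus_shift[of \<mu> "x - xs" "s *\<^sub>R f x"]
    by (simp add: g_def algebra_simps)
  moreover have "(g - f xs) \<bullet> (x - xs) = (g - f xs) \<bullet> (?y - xs) + s * (g \<bullet> f x) - s * (f xs \<bullet> f x)"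
    by (simp add: inner_diff_left inner_diff_right algebra_simps)
  moreover have "g \<bullet> f x = ((norm g)\<^sup>2 + (norm (f x))\<^sup>2 - (norm (g - f x))\<^sup>2) / 2"
    by (simp add: power2_norm_eq_inner inner_diff_left inner_diff_right inner_commute)
  then have "s * (g \<bullet> f x) \<ge> s * (((norm g)\<^sup>2 + (norm (f x))\<^sup>2 - (s * L)\<^sup>2 * (norm (f x))\<^sup>2) / 2)"
    using dist s by (intro mult_left_mono) auto
  ultimately have "(g - f xs) \<bullet> (x - xs) \<ge> shifted_modulus \<mu> * (norm (x - xs))\<^sup>2
      - 2 * \<bar>\<mu>\<bar> * (norm (s *\<^sub>R f x))\<^sup>2
      + s * (((norm g)\<^sup>2 + (norm (f x))\<^sup>2 - (s * L)\<^sup>2 * (norm (f x))\<^sup>2) / 2) - s * (f xs \<bullet> f x)"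
    by linarith
  from mult_left_mono[OF this s] show ?thesis
    using s by (simp add: power_mult_distrib power2_eq_square algebra_simps add_divide_distrib diff_divide_distrib)
qed

lemma norm_extrapolated_ge:
  fixes f :: "'a::real_inner \<Rightarrow> 'a"
  assumes lip: "L-lipschitz_on UNIV f" and s: "0 \<le> s" "s * L \<le> 1 / 6"
  shows "25 / 36 * (norm (f x))\<^sup>2 \<le> (norm (f (x - s *\<^sub>R f x)))\<^sup>2"
proof -
  have "norm (f (x - s *\<^sub>R f x) - f x) \<le> L * norm (s *\<^sub>R f x)"
    using lipschitz_onD[OF lip, of "x - s *\<^sub>R f x" x] by (simp add: dist_norm)
  also have "\<dots> = (s * L) * norm (f x)" using s by simp
  also have "\<dots> \<le> 1 / 6 * norm (f x)" using s by (intro mult_right_mono) auto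
  finally have "5 / 6 * norm (f x) \<le> norm (f (x - s *\<^sub>R f x))"
    using norm_triangle_ineq3[of "f x" "f (x - s *\<^sub>R f x)"] by (simp add: norm_minus_commute)
  then have "(5 / 6 * norm (f x))\<^sup>2 \<le> (norm (f (x - s *\<^sub>R f x)))\<^sup>2" by (simp add: power_mono)
  then show ?thesis by (simp add: power_mult_distrib power2_eq_square)
qed

text \<open>The bound \<open>1 / 6\<close> on the step makes \<open>g\<close> and \<open>f x\<close> comparable in norm, so that the cross terms
  with \<open>f xs\<close> can be absorbed in both squares.\<close>

locale extragradient_sample =
  fixes f :: "'a::real_inner \<Rightarrow> 'a" and L \<mu> s :: real and xs :: 'a
  assumes lip: "L-lipschitz_on UNIV f" and s: "0 \<le> s" "s * L \<le> 1 / 6"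
    and mono: "\<And>y. (f y - f xs) \<bullet> (y - xs) \<ge> \<mu> * (norm (y - xs))\<^sup>2"
    and mu: "\<bar>\<mu>\<bar> \<le> L"
begin

lemma small_step: "0 \<le> s * L" "\<bar>\<mu>\<bar> * s \<le> 1/6" "(s * L)\<^sup>2 \<le> 1/36"
proof -
  show 0: "0 \<le> s * L" using s mu by (intro mult_nonneg_nonneg) auto
  show "\<bar>\<mu>\<bar> * s \<le> 1/6" using mult_right_mono[OF mu, of s] s by (simp add: mult.commute)
  show "(s * L)\<^sup>2 \<le> 1/36" using power_mono[OF s(2) 0, of 2] by (simp add: power2_eq_square)
qed

text \<open>Four times the basic inequality contains \<open>2 * s\<^sup>2 * (norm g)\<^sup>2\<close>, twice what is wanted. The
  surplus square, bounded below by \<open>25/36\<close> of \<open>(norm (f x))\<^sup>2\<close>, joins the remaining coefficient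
  \<open>11/18\<close> of \<open>(norm (f x))\<^sup>2\<close>, and together they dominate the cross term.\<close>

lemma sample_second_moment:
  "s\<^sup>2 * (norm (f (x - s *\<^sub>R f x)))\<^sup>2 \<le> 4 * (s * ((f (x - s *\<^sub>R f x) - f xs) \<bullet> (x - xs)))
     - 4 * (s * shifted_modulus \<mu> * (norm (x - xs))\<^sup>2) + 6 * (s\<^sup>2 * (norm (f xs))\<^sup>2)"
proof -
  define g where "g = f (x - s *\<^sub>R f x)"
  have "11/18 * (norm (f x))\<^sup>2 \<le> (2 * (1 - (s * L)\<^sup>2) - 8 * \<bar>\<mu>\<bar> * s) * (norm (f x))\<^sup>2"
    using small_step by (intro mult_right_mono) auto
  moreover have "0 \<le> 47/36 * (norm (f x))\<^sup>2 - 2 * 2 * (f x \<bullet> f xs) + 6 * (norm (f xs))\<^sup>2"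
    by (rule quadratic_form_nonneg) (auto simp: power2_eq_square)
  ultimately have "0 \<le> (norm g)\<^sup>2 + (2 * (1 - (s * L)\<^sup>2) - 8 * \<bar>\<mu>\<bar> * s) * (norm (f x))\<^sup>2
      - 4 * (f xs \<bullet> f x) + 6 * (norm (f xs))\<^sup>2"
    using norm_extrapolated_ge[OF lip s, of x] inner_commute[of "f x" "f xs"]
    unfolding g_def[symmetric] by linarith
  from mult_nonneg_nonneg[OF zero_le_power2[of s] this]
    extragradient_step_lower[OF lip s(1) mono, of x, folded g_def]
  show ?thesis unfolding g_def[symmetric] by (simp add: algebra_simps)
qed

lemma sample_progress:
  "s * ((f (x - s *\<^sub>R f x) - f xs) \<bullet> (x - xs)) \<ge> s * shifted_modulus \<mu> * (norm (x - xs))\<^sup>2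
     + 1/2 * (s\<^sup>2 * ((1 - 4 * \<bar>\<mu>\<bar> * s - 2 * (s * L)\<^sup>2) * (norm (f x))\<^sup>2))
     - 3/2 * (s\<^sup>2 * (norm (f xs))\<^sup>2)"
proof -
  define g where "g = f (x - s *\<^sub>R f x)"
  have "0 \<le> 25/72 * (norm (f x))\<^sup>2 - 2 * (1/2) * (f x \<bullet> f xs) + 3/2 * (norm (f xs))\<^sup>2"
    by (rule quadratic_form_nonneg) (auto simp: power2_eq_square)
  moreover have "0 \<le> 1/2 * (s * L)\<^sup>2 * (norm (f x))\<^sup>2" by simp
  ultimately have "0 \<le> 1/2 * (norm g)\<^sup>2 + 1/2 * (s * L)\<^sup>2 * (norm (f x))\<^sup>2
      - (f xs \<bullet> f x) + 3/2 * (norm (f xs))\<^sup>2"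
    using norm_extrapolated_ge[OF lip s, of x] inner_commute[of "f x" "f xs"]
    unfolding g_def[symmetric] by linarith
  from mult_nonneg_nonneg[OF zero_le_power2[of s] this]
    extragradient_step_lower[OF lip s(1) mono, of x, folded g_def]
  show ?thesis unfolding g_def[symmetric] by (simp add: algebra_simps)
qed

text \<open>The distance decrease of one step divided by \<open>\<alpha>\<close>. Adding the two previous estimates would
  cost \<open>6 * \<alpha> + 3 * (1 - 2 * \<alpha>)\<close> instead of \<open>6 * \<alpha> + 3/2\<close> times the noise, because the lower
  bound on the inner product may be negative and then cannot be scaled down; one joint estimate
  from the basic inequality avoids this loss.\<close>

lemma sample_descent:
  assumes "0 \<le> \<alpha>" "\<alpha> \<le> 1/4"
  shows "\<alpha> * (s\<^sup>2 * (norm (f (x - s *\<^sub>R f x)))\<^sup>2) - 2 * (s * ((f (x - s *\<^sub>R f x) - f xs) \<bullet> (x - xs)))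
    \<le> - 2 * (s * shifted_modulus \<mu> * (norm (x - xs))\<^sup>2)
     - 1/2 * (s\<^sup>2 * ((1 - 4 * \<bar>\<mu>\<bar> * s - 2 * (s * L)\<^sup>2) * (norm (f x))\<^sup>2))
     + (6 * \<alpha> + 3/2) * (s\<^sup>2 * (norm (f xs))\<^sup>2)"
proof -
  define g where "g = f (x - s *\<^sub>R f x)"
  have "1/6 * (norm (f x))\<^sup>2 \<le> (1/2 * (1 - 4 * \<bar>\<mu>\<bar> * s)) * (norm (f x))\<^sup>2"
    using small_step by (intro mult_right_mono) (auto simp: mult_ac)
  moreover have "(1 - \<alpha>) * (25 / 36 * (norm (f x))\<^sup>2) \<le> (1 - \<alpha>) * (norm g)\<^sup>2"
    using norm_extrapolated_ge[OF lip s, of x] assms unfolding g_def[symmetric]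
    by (intro mult_left_mono) auto
  moreover have "0 \<le> ((1 - \<alpha>) * (25/36) + 1/6) * (norm (f x))\<^sup>2 - 2 * 1 * (f x \<bullet> f xs)
      + (6 * \<alpha> + 3/2) * (norm (f xs))\<^sup>2"
  proof (rule quadratic_form_nonneg)
    \<comment> \<open>The right-hand side is concave in \<open>\<alpha>\<close> and exceeds 1 at both ends of \<open>[0, 1/4]\<close>.\<close>
    have "0 \<le> \<alpha> * (1/4 - \<alpha>)" using assms by simp
    then show "1\<^sup>2 \<le> ((1 - \<alpha>) * (25/36) + 1/6) * (6 * \<alpha> + 3/2)"
      using assms by (simp add: field_simps)
  qed (use assms in auto)
  ultimately have "0 \<le> (1 - \<alpha>) * (norm g)\<^sup>2 + (1/2 * (1 - 4 * \<bar>\<mu>\<bar> * s)) * (norm (f x))\<^sup>2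
      - 2 * (f xs \<bullet> f x) + (6 * \<alpha> + 3/2) * (norm (f xs))\<^sup>2"
    by (simp add: inner_commute algebra_simps)
  from mult_nonneg_nonneg[OF zero_le_power2[of s] this]
    extragradient_step_lower[OF lip s(1) mono, of x, folded g_def]
  show ?thesis unfolding g_def[symmetric] by (simp add: algebra_simps)
qed

end

section \<open>Averaging out an independent sample\<close>

text \<open>If the finitely valued \<open>Z\<close> is independent of \<open>X\<close>, conditioning on \<open>X\<close> amounts to averaging over
  \<open>Z\<close> with \<open>X\<close> frozen: write \<open>h (Z \<omega>) (X \<omega>)\<close> as a sum over the values \<open>i\<close> of \<open>Z\<close> of
  \<open>indicator {i} (Z \<omega>) * h i (X \<omega>)\<close>, and factor the integral of each summand over every event
  determined by \<open>X\<close>. Independence is assumed for real functions of \<open>Z\<close> and \<open>X\<close>, because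
  \<^const>\<open>prob_space.indep_var\<close> requires both variables to take values in the same type.\<close>

lemma cond_exp_independent_sample:
  fixes X :: "'s \<Rightarrow> 'a::topological_space" and h :: "'i \<Rightarrow> 'a \<Rightarrow> real"
  assumes "prob_space M" and I: "finite I"
    and X[measurable]: "X \<in> borel_measurable M" and Z[measurable]: "Z \<in> measurable M (count_space I)"
    and ind: "\<forall>i\<in>I. \<forall>u\<in>borel_measurable borel.
        prob_space.indep_var M borel (\<lambda>\<omega>. indicator {i} (Z \<omega>) :: real) borel (\<lambda>\<omega>. u (X \<omega>))"
    and hmeas: "\<forall>i\<in>I. h i \<in> borel_measurable borel"
    and hint: "\<forall>i\<in>I. integrable M (\<lambda>\<omega>. h i (X \<omega>))"
  defines "E \<equiv> \<lambda>x. \<Sum>i\<in>I. measure M {\<omega> \<in> space M. Z \<omega> = i} * h i x"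
  shows "integrable M (\<lambda>\<omega>. h (Z \<omega>) (X \<omega>))"
    and "AE \<omega> in M. cond_exp_given M X (\<lambda>\<omega>. h (Z \<omega>) (X \<omega>)) \<omega> = E (X \<omega>)"
    and "(\<integral>\<omega>. h (Z \<omega>) (X \<omega>) \<partial>M) = (\<integral>\<omega>. E (X \<omega>) \<partial>M)"
    and "integrable M (\<lambda>\<omega>. E (X \<omega>))"
proof -
  interpret prob_space M by fact
  let ?N = "vimage_algebra (space M) X borel"
  have sub: "subalgebra M ?N"
    unfolding subalgebra_def
    by (auto simp: sets_vimage_algebra2 measurable_sets[OF X])
  interpret S: finite_measure_subalgebra M ?N
    by unfold_locales (fact sub)
  have XN: "X \<in> measurable ?N borel" by (rule measurable_vimage_algebra1) auto
  let ?ind = "\<lambda>i \<omega>. indicator {i} (Z \<omega>) :: real"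
  have split: "h (Z \<omega>) (X \<omega>) = (\<Sum>i\<in>I. ?ind i \<omega> * h i (X \<omega>))" if "\<omega> \<in> space M" for \<omega>
  proof -
    have "Z \<omega> \<in> I" using measurable_space[OF Z that] by simp
    then have "(\<Sum>i\<in>I. ?ind i \<omega> * h i (X \<omega>)) = (\<Sum>i\<in>I. if Z \<omega> = i then h i (X \<omega>) else 0)"
      by (intro sum.cong) (auto simp: indicator_def)
    also have "\<dots> = h (Z \<omega>) (X \<omega>)" using I \<open>Z \<omega> \<in> I\<close> by simp
    finally show ?thesis by simp
  qed
  have indI: "(\<integral>\<omega>. ?ind i \<omega> \<partial>M) = measure M {\<omega> \<in> space M. Z \<omega> = i}"
    and intI: "integrable M (?ind i)" if "i \<in> I" for i
  proof -
    have m: "{\<omega> \<in> space M. Z \<omega> = i} \<in> sets M"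
      using measurable_sets[OF Z, of "{i}"] that by (simp add: vimage_def Int_def conj_commute)
    have eq: "?ind i \<omega> = indicator {\<omega> \<in> space M. Z \<omega> = i} \<omega>" if "\<omega> \<in> space M" for \<omega>
      using that by (auto simp: indicator_def)
    show "(\<integral>\<omega>. ?ind i \<omega> \<partial>M) = measure M {\<omega> \<in> space M. Z \<omega> = i}"
      using m by (subst Bochner_Integration.integral_cong[OF refl eq]) (auto intro!: arg_cong[where f=prob])
    have "integrable M (indicator {\<omega> \<in> space M. Z \<omega> = i} :: _ \<Rightarrow> real)"
      using m by (auto intro!: integrable_real_indicator simp: emeasure_finite less_top[symmetric])
    then show "integrable M (?ind i)"
      by (subst Bochner_Integration.integrable_cong[OF refl eq]) auto
  qed
  have indep: "integrable M (\<lambda>\<omega>. ?ind i \<omega> * u (X \<omega>))"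
       "(\<integral>\<omega>. ?ind i \<omega> * u (X \<omega>) \<partial>M) = measure M {\<omega> \<in> space M. Z \<omega> = i} * (\<integral>\<omega>. u (X \<omega>) \<partial>M)"
    if i: "i \<in> I" and u: "u \<in> borel_measurable borel" "integrable M (\<lambda>\<omega>. u (X \<omega>))" for i u
  proof -
    note 1 = ind[rule_format, OF i u(1)]
    show "integrable M (\<lambda>\<omega>. ?ind i \<omega> * u (X \<omega>))"
      by (rule indep_var_integrable[OF 1 intI[OF i] u(2)])
    show "(\<integral>\<omega>. ?ind i \<omega> * u (X \<omega>) \<partial>M) = measure M {\<omega> \<in> space M. Z \<omega> = i} * (\<integral>\<omega>. u (X \<omega>) \<partial>M)"
      using indep_var_lebesgue_integral[OF 1 intI[OF i] u(2)] indI[OF i] by simp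
  qed
  show int1: "integrable M (\<lambda>\<omega>. h (Z \<omega>) (X \<omega>))"
    using indep(1)[OF _ hmeas[rule_format] hint[rule_format]]
    by (subst Bochner_Integration.integrable_cong[OF refl split]) auto
  show int2: "integrable M (\<lambda>\<omega>. E (X \<omega>))"
    unfolding E_def by (intro Bochner_Integration.integrable_sum integrable_mult_right hint[rule_format])
  have EN: "(\<lambda>\<omega>. E (X \<omega>)) \<in> borel_measurable ?N"
    unfolding E_def
    by (intro borel_measurable_sum borel_measurable_times borel_measurable_const
        measurable_compose[OF XN] hmeas[rule_format])
  have setint: "(\<integral> \<omega> \<in> A. h (Z \<omega>) (X \<omega>) \<partial>M) = (\<integral> \<omega> \<in> A. E (X \<omega>) \<partial>M)" if "A \<in> sets ?N" for A
  proof -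
    from that obtain B where B: "B \<in> sets borel" "A = X -` B \<inter> space M"
      by (auto simp: sets_vimage_algebra2)
    let ?u = "\<lambda>i x. indicator B x * h i x :: real"
    have um: "?u i \<in> borel_measurable borel" if "i \<in> I" for i
      using B hmeas[rule_format, OF that] by simp
    have ui: "integrable M (\<lambda>\<omega>. ?u i (X \<omega>))" if "i \<in> I" for i
    proof (rule Bochner_Integration.integrable_bound[OF hint[rule_format, OF that]])
      show "(\<lambda>\<omega>. ?u i (X \<omega>)) \<in> borel_measurable M" using measurable_compose[OF X um[OF that]] .
    qed (auto simp: indicator_def)
    have "(\<integral> \<omega> \<in> A. h (Z \<omega>) (X \<omega>) \<partial>M) = (\<integral>\<omega>. (\<Sum>i\<in>I. ?ind i \<omega> * ?u i (X \<omega>)) \<partial>M)"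
      unfolding set_lebesgue_integral_def
      by (intro Bochner_Integration.integral_cong)
         (auto simp: split B(2) sum_distrib_left indicator_def intro!: sum.cong)
    also have "\<dots> = (\<Sum>i\<in>I. measure M {\<omega> \<in> space M. Z \<omega> = i} * (\<integral>\<omega>. ?u i (X \<omega>) \<partial>M))"
      using indep[OF _ um ui] by (subst Bochner_Integration.integral_sum) auto
    also have "\<dots> = (\<integral>\<omega>. (\<Sum>i\<in>I. measure M {\<omega> \<in> space M. Z \<omega> = i} * ?u i (X \<omega>)) \<partial>M)"
      using ui by (subst Bochner_Integration.integral_sum) auto
    also have "\<dots> = (\<integral> \<omega> \<in> A. E (X \<omega>) \<partial>M)"
      unfolding set_lebesgue_integral_def E_def
      by (intro Bochner_Integration.integral_cong)
         (auto simp: B(2) sum_distrib_left indicator_def)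
    finally show ?thesis .
  qed
  show "AE \<omega> in M. cond_exp_given M X (\<lambda>\<omega>. h (Z \<omega>) (X \<omega>)) \<omega> = E (X \<omega>)"
    unfolding cond_exp_given_def
    by (rule S.real_cond_exp_charact[OF setint int1 int2 EN])
  have "space M \<in> sets ?N" using sets.top[of ?N] by simp
  from setint[OF this] show "(\<integral>\<omega>. h (Z \<omega>) (X \<omega>) \<partial>M) = (\<integral>\<omega>. E (X \<omega>) \<partial>M)"
    using int1 int2 by (simp add: set_integral_space)
qed

text \<open>The iterate with index \<open>k\<close> uses only the samples before \<open>k\<close>; this is what makes sample \<open>k\<close> fresh.\<close>

lemma s_seg_cong:
  assumes "\<And>j. j < k \<Longrightarrow> \<xi> j = \<xi>' j"
  shows "s_seg F \<gamma>1 \<gamma>2 x0 \<xi> k = s_seg F \<gamma>1 \<gamma>2 x0 \<xi>' k"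
  using assms by (induction k) auto

text \<open>With finitely many samples to choose from, an iterate takes finitely many values. Every
  measurable function of it is therefore bounded, hence integrable, without moment estimates.\<close>

lemma finite_range_s_seg:
  assumes "finite I" "\<And>j \<omega>. \<omega> \<in> S \<Longrightarrow> \<xi> j \<omega> \<in> I"
  shows "finite ((\<lambda>\<omega>. s_seg F \<gamma>1 \<gamma>2 x0 (\<lambda>j. \<xi> j \<omega>) k) ` S)"
proof (induction k)
  case (Suc k)
  let ?X = "\<lambda>\<omega>. s_seg F \<gamma>1 \<gamma>2 x0 (\<lambda>j. \<xi> j \<omega>) k"
  have "(\<lambda>\<omega>. s_seg F \<gamma>1 \<gamma>2 x0 (\<lambda>j. \<xi> j \<omega>) (Suc k)) ` S
     \<subseteq> (\<lambda>(i, x). x - \<gamma>2 i *\<^sub>R seg_direction F \<gamma>1 i x) ` (I \<times> ?X ` S)"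
    using assms(2) by fastforce
  then show ?case using Suc assms(1) by (elim finite_subset) auto
next
  case 0
  have "(\<lambda>\<omega>. s_seg F \<gamma>1 \<gamma>2 x0 (\<lambda>j. \<xi> j \<omega>) 0) ` S \<subseteq> {x0}" by auto
  then show ?case by (rule finite_subset) simp
qed

lemma measurable_s_seg:
  fixes F :: "'i \<Rightarrow> 'a::euclidean_space \<Rightarrow> 'a"
  assumes "countable I" "\<And>i. i \<in> I \<Longrightarrow> continuous_on UNIV (F i)"
    and "\<And>j. j < k \<Longrightarrow> (\<lambda>\<omega>. \<xi> j \<omega>) \<in> measurable N (count_space I)"
  shows "(\<lambda>\<omega>. s_seg F \<gamma>1 \<gamma>2 x0 (\<lambda>j. \<xi> j \<omega>) k) \<in> borel_measurable N"
  using assms(3)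
proof (induction k)
  case (Suc k)
  let ?X = "\<lambda>\<omega>. s_seg F \<gamma>1 \<gamma>2 x0 (\<lambda>j. \<xi> j \<omega>) k"
  have X: "?X \<in> borel_measurable N" using Suc by simp
  have "(\<lambda>\<omega>. ?X \<omega> - \<gamma>2 i *\<^sub>R seg_direction F \<gamma>1 i (?X \<omega>)) \<in> borel_measurable N"
    if "i \<in> I" for i
  proof -
    have [measurable]: "F i \<in> borel_measurable borel"
      using assms(2)[OF that] by (simp add: borel_measurable_continuous_onI)
    show ?thesis unfolding seg_direction_def using X by measurable
  qed
  from measurable_compose_countable'[OF this _ assms(1), where g="\<xi> k"] Suc.prems
  show ?case by simp
qed simp

lemma indep_var_sample_iterate:
  fixes F :: "'i \<Rightarrow> 'a::euclidean_space \<Rightarrow> 'a" and u :: "'a \<Rightarrow> 'b::topological_space" and v :: "'i \<Rightarrow> 'b"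
  assumes "prob_space M" "prob_space.indep_vars M (\<lambda>_. count_space I) \<xi> UNIV"
    and "countable I" "\<And>i. i \<in> I \<Longrightarrow> continuous_on UNIV (F i)"
    and u: "u \<in> borel_measurable borel"
  shows "prob_space.indep_var M borel (\<lambda>\<omega>. v (\<xi> k \<omega>))
    borel (\<lambda>\<omega>. u (s_seg F \<gamma>1 \<gamma>2 x0 (\<lambda>j. \<xi> j \<omega>) k))"
proof -
  interpret prob_space M by fact
  let ?P = "\<lambda>A. PiM A (\<lambda>_. count_space I)"
  have 1: "indep_var (?P {k}) (\<lambda>\<omega>. restrict (\<lambda>i. \<xi> i \<omega>) {k}) (?P {..<k}) (\<lambda>\<omega>. restrict (\<lambda>i. \<xi> i \<omega>) {..<k})"
    using indep_var_restrict[OF assms(2), of "{k}" "{..<k}"] by auto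
  have 2: "(\<lambda>f. u (s_seg F \<gamma>1 \<gamma>2 x0 (\<lambda>j. f j) k)) \<in> measurable (?P {..<k}) borel"
    using assms(3,4) by (intro measurable_compose[OF measurable_s_seg u]) auto
  have 3: "(\<lambda>f. v (f k)) \<in> measurable (?P {k}) borel"
    by (rule measurable_compose[OF measurable_component_singleton[of k "{k}"]]) auto
  have "(\<lambda>f. u (s_seg F \<gamma>1 \<gamma>2 x0 (\<lambda>j. f j) k)) \<circ> (\<lambda>\<omega>. restrict (\<lambda>i. \<xi> i \<omega>) {..<k})
      = (\<lambda>\<omega>. u (s_seg F \<gamma>1 \<gamma>2 x0 (\<lambda>j. \<xi> j \<omega>) k))"
    by (auto simp: fun_eq_iff intro!: arg_cong[where f=u] s_seg_cong)
  moreover have "(\<lambda>f. v (f k)) \<circ> (\<lambda>\<omega>. restrict (\<lambda>i. \<xi> i \<omega>) {k}) = (\<lambda>\<omega>. v (\<xi> k \<omega>))" by (auto simp: fun_eq_iff)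
  ultimately show ?thesis using indep_var_compose[OF 1 3 2] by simp
qed

section \<open>Averages under importance sampling\<close>

locale importance_sampled_seg =
  fixes n :: nat and F :: "nat \<Rightarrow> 'a::euclidean_space \<Rightarrow> 'a" and L \<mu> :: "nat \<Rightarrow> real"
    and \<gamma> \<alpha> :: real and xs :: 'a
  assumes n: "n \<ge> 1"
    and L_pos: "\<And>i. i \<in> {1..n} \<Longrightarrow> L i > 0"
    and F_lip: "\<And>i. i \<in> {1..n} \<Longrightarrow> (L i)-lipschitz_on UNIV (F i)"
    and F_mono: "\<And>i y. i \<in> {1..n} \<Longrightarrow> (F i y - F i xs) \<bullet> (y - xs) \<ge> \<mu> i * (norm (y - xs))\<^sup>2"
    and mu_le: "\<And>i. i \<in> {1..n} \<Longrightarrow> \<bar>\<mu> i\<bar> \<le> L i"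
    and root: "mean_operator n F xs = 0"
    and mu_bar_nonneg: "mu_bar n \<mu> \<ge> 0"
    and \<gamma>: "0 < \<gamma>" "\<gamma> \<le> 1 / (6 * mean_real n L)"
    and \<alpha>: "0 < \<alpha>" "\<alpha> < 1"
begin

abbreviation "Lbar \<equiv> mean_real n L"
abbreviation "\<sigma>2 \<equiv> sigma_IS_sq n F L xs"
abbreviation "W \<equiv> weighted_residual n F L \<mu> \<gamma>"
abbreviation "\<rho> \<equiv> \<alpha> * \<gamma> * mu_bar n \<mu> / 2"

text \<open>The extrapolation stepsize, which makes the product \<open>s i * L i\<close> the same for every \<open>i\<close>.\<close>

definition s :: "nat \<Rightarrow> real" where "s i = \<gamma> * Lbar / L i"

abbreviation "g \<equiv> seg_direction F s"

definition avg :: "(nat \<Rightarrow> real) \<Rightarrow> real" where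
  "avg h = (\<Sum>i=1..n. L i / (\<Sum>j=1..n. L j) * h i)"

lemma Lbar_pos: "Lbar > 0"
  unfolding mean_real_def using n L_pos by (intro mult_pos_pos sum_pos) auto

lemma sum_L: "(\<Sum>j=1..n. L j) = real n * Lbar"
  using n by (simp add: mean_real_def)

lemma avg_alt: "avg h = (\<Sum>i=1..n. L i / (real n * Lbar) * h i)"
  unfolding avg_def sum_L ..

lemma s_facts:
  assumes "i \<in> {1..n}" shows "s i > 0" "s i * L i = \<gamma> * Lbar" "s i * L i \<le> 1 / 6"
proof -
  show "s i > 0" using Lbar_pos \<gamma>(1) L_pos[OF assms] by (simp add: s_def)
  show *: "s i * L i = \<gamma> * Lbar" using L_pos[OF assms] by (simp add: s_def)
  show "s i * L i \<le> 1 / 6" unfolding * using Lbar_pos \<gamma> by (simp add: field_simps)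
qed

lemma avg_cong: "(\<And>i. i \<in> {1..n} \<Longrightarrow> h i = h' i) \<Longrightarrow> avg h = avg h'"
  unfolding avg_def by (intro sum.cong) auto

lemma avg_mono:
  assumes "\<And>i. i \<in> {1..n} \<Longrightarrow> h i \<le> h' i" shows "avg h \<le> avg h'"
  unfolding avg_alt using assms L_pos Lbar_pos
  by (intro sum_mono mult_left_mono divide_nonneg_nonneg) (auto simp: less_imp_le)

lemma avg_linear:
  "avg (\<lambda>i. h i + h' i) = avg h + avg h'"
  "avg (\<lambda>i. h i - h' i) = avg h - avg h'"
  "avg (\<lambda>i. c * h i) = c * avg h"
  by (simp_all only: avg_alt distrib_left right_diff_distrib sum.distrib sum_subtractf sum_distrib_left
      mult.left_commute)

lemma avg_const: "avg (\<lambda>_. c) = c"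
proof -
  have "avg (\<lambda>_. c) = (\<Sum>i=1..n. L i) / (real n * Lbar) * c"
    by (simp only: avg_alt sum_distrib_right sum_divide_distrib)
  then show ?thesis unfolding sum_L using n Lbar_pos by simp
qed

text \<open>Probabilities are proportional to \<open>L i\<close> and stepsizes to \<open>1 / L i\<close>, so one factor of the stepsize
  turns the weighted average into the uniform one. This makes \<^const>\<open>mu_bar\<close> and the mean
  operator appear, and a second factor leaves the weights \<open>Lbar / L i\<close> of the noise and of the
  residual.\<close>

lemma avg_s: "avg (\<lambda>i. s i * u i) = \<gamma> * ((1 / real n) * (\<Sum>i=1..n. u i))"
proof -
  have "avg (\<lambda>i. s i * u i) = (\<Sum>i=1..n. \<gamma> * ((1 / real n) * u i))"
    unfolding avg_alt
  proof (intro sum.cong refl)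
    fix i assume "i \<in> {1..n}"
    then have "L i > 0" by (rule L_pos)
    then show "L i / (real n * Lbar) * (s i * u i) = \<gamma> * ((1 / real n) * u i)"
      using Lbar_pos by (simp add: s_def)
  qed
  then show ?thesis by (simp add: sum_distrib_left)
qed

lemma avg_s_sq: "avg (\<lambda>i. (s i)\<^sup>2 * v i) = \<gamma>\<^sup>2 * ((1 / real n) * (\<Sum>i=1..n. Lbar / L i * v i))"
proof -
  have "avg (\<lambda>i. (s i)\<^sup>2 * v i) = avg (\<lambda>i. s i * (\<gamma> * (Lbar / L i * v i)))"
    by (intro avg_cong) (simp add: power2_eq_square s_def)
  then show ?thesis unfolding avg_s sum_distrib_left[symmetric] by (simp add: power2_eq_square)
qed

lemma avg_s_shifted_modulus: "avg (\<lambda>i. s i * shifted_modulus (\<mu> i) * c) = \<gamma> * mu_bar n \<mu> / 2 * c"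
proof -
  have "(\<Sum>i=1..n. shifted_modulus (\<mu> i)) = (\<Sum>i | i \<in> {1..n} \<and> \<mu> i \<ge> 0. \<mu> i) / 2 + 2 * (\<Sum>i | i \<in> {1..n} \<and> \<mu> i < 0. \<mu> i)"
    unfolding shifted_modulus_def
    by (subst sum.If_cases)
       (auto simp: sum_divide_distrib sum_distrib_left Int_def Compl_eq not_le intro!: arg_cong2[where f="(+)"] sum.cong)
  then have "(1 / real n) * (\<Sum>i=1..n. shifted_modulus (\<mu> i)) = mu_bar n \<mu> / 2"
    by (simp only: mu_bar_def) (simp add: distrib_left add_divide_distrib)
  moreover have "avg (\<lambda>i. s i * shifted_modulus (\<mu> i) * c)
      = \<gamma> * ((1 / real n) * (\<Sum>i=1..n. shifted_modulus (\<mu> i))) * c"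
    using avg_s[of "\<lambda>i. shifted_modulus (\<mu> i) * c"] by (simp add: mult.assoc sum_distrib_right[symmetric])
  ultimately show ?thesis by (simp only: times_divide_eq_right)
qed

lemma avg_s_root: "avg (\<lambda>i. s i * (F i xs \<bullet> z)) = 0"
proof -
  have "(\<Sum>i=1..n. F i xs) = 0" using root n by (simp add: mean_operator_def)
  then show ?thesis by (simp add: avg_s inner_sum_left[symmetric])
qed

text \<open>On average the centring is free, as the operators sum to zero at \<open>xs\<close>.\<close>

lemma avg_s_centred:
  "avg (\<lambda>i. s i * ((g i x - F i xs) \<bullet> z)) = avg (\<lambda>i. s i * (g i x \<bullet> z))"
  using avg_linear(2)[of "\<lambda>i. s i * (g i x \<bullet> z)" "\<lambda>i. s i * (F i xs \<bullet> z)"]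
  by (simp add: avg_s_root inner_diff_left right_diff_distrib)

lemma avg_sigma: "avg (\<lambda>i. (s i)\<^sup>2 * (norm (F i xs))\<^sup>2) = \<gamma>\<^sup>2 * \<sigma>2"
  by (simp add: avg_s_sq sigma_IS_sq_def)

lemma avg_W:
  "avg (\<lambda>i. (s i)\<^sup>2 * ((1 - 4 * \<bar>\<mu> i\<bar> * s i - 2 * (s i * L i)\<^sup>2) * (norm (F i x))\<^sup>2)) = \<gamma>\<^sup>2 * W x"
proof -
  have "avg (\<lambda>i. (s i)\<^sup>2 * ((1 - 4 * \<bar>\<mu> i\<bar> * s i - 2 * (s i * L i)\<^sup>2) * (norm (F i x))\<^sup>2))
    = avg (\<lambda>i. (s i)\<^sup>2 * ((1 - 4 * (\<bar>\<mu> i\<bar> / L i) * Lbar * \<gamma> - 2 * Lbar\<^sup>2 * \<gamma>\<^sup>2) * (norm (F i x))\<^sup>2))"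
    by (intro avg_cong) (simp add: s_facts(2), simp add: s_def power_mult_distrib mult_ac)
  then show ?thesis by (simp add: avg_s_sq weighted_residual_def mult.assoc)
qed

lemma sample: "i \<in> {1..n} \<Longrightarrow> extragradient_sample (F i) (L i) (\<mu> i) (s i) xs"
  using F_lip s_facts F_mono mu_le by unfold_locales (auto simp: less_imp_le)

lemma avg_second_moment:
  "avg (\<lambda>i. (\<alpha> * s i)\<^sup>2 * (norm (g i x))\<^sup>2)
    \<le> 4 * \<alpha> * avg (\<lambda>i. \<alpha> * s i * (g i x \<bullet> (x - xs))) + 6 * \<alpha>\<^sup>2 * \<gamma>\<^sup>2 * \<sigma>2"
proof -
  have "avg (\<lambda>i. (s i)\<^sup>2 * (norm (g i x))\<^sup>2)
      \<le> avg (\<lambda>i. 4 * (s i * ((g i x - F i xs) \<bullet> (x - xs)))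
        - 4 * (s i * shifted_modulus (\<mu> i) * (norm (x - xs))\<^sup>2) + 6 * ((s i)\<^sup>2 * (norm (F i xs))\<^sup>2))"
    using extragradient_sample.sample_second_moment[OF sample]
    by (intro avg_mono) (simp add: seg_direction_def)
  also have "\<dots> = 4 * avg (\<lambda>i. s i * (g i x \<bullet> (x - xs))) - 2 * \<gamma> * mu_bar n \<mu> * (norm (x - xs))\<^sup>2 + 6 * (\<gamma>\<^sup>2 * \<sigma>2)"
    by (simp add: avg_linear avg_s_centred avg_s_shifted_modulus avg_sigma)
  also have "\<dots> \<le> 4 * avg (\<lambda>i. s i * (g i x \<bullet> (x - xs))) + 6 * (\<gamma>\<^sup>2 * \<sigma>2)"
    using mu_bar_nonneg \<gamma>(1) by simp
  finally have "\<alpha>\<^sup>2 * avg (\<lambda>i. (s i)\<^sup>2 * (norm (g i x))\<^sup>2)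
      \<le> \<alpha>\<^sup>2 * (4 * avg (\<lambda>i. s i * (g i x \<bullet> (x - xs))) + 6 * (\<gamma>\<^sup>2 * \<sigma>2))"
    by (intro mult_left_mono) auto
  then show ?thesis
    by (simp add: power_mult_distrib avg_linear mult.assoc) (simp add: power2_eq_square algebra_simps)
qed

lemma avg_progress:
  "\<rho> * (norm (x - xs))\<^sup>2 + 1 / 2 * (\<alpha> * \<gamma>\<^sup>2 * W x) - 3 * \<alpha> * \<gamma>\<^sup>2 / 2 * \<sigma>2
    \<le> avg (\<lambda>i. \<alpha> * s i * (g i x \<bullet> (x - xs)))"
proof -
  have "avg (\<lambda>i. s i * shifted_modulus (\<mu> i) * (norm (x - xs))\<^sup>2
     + 1/2 * ((s i)\<^sup>2 * ((1 - 4 * \<bar>\<mu> i\<bar> * s i - 2 * (s i * L i)\<^sup>2) * (norm (F i x))\<^sup>2))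
     - 3/2 * ((s i)\<^sup>2 * (norm (F i xs))\<^sup>2))
     \<le> avg (\<lambda>i. s i * ((g i x - F i xs) \<bullet> (x - xs)))"
    using extragradient_sample.sample_progress[OF sample]
    by (intro avg_mono) (simp add: seg_direction_def)
  then have "\<alpha> * (\<gamma> * mu_bar n \<mu> / 2 * (norm (x - xs))\<^sup>2 + 1/2 * (\<gamma>\<^sup>2 * W x) - 3/2 * (\<gamma>\<^sup>2 * \<sigma>2))
     \<le> \<alpha> * avg (\<lambda>i. s i * (g i x \<bullet> (x - xs)))"
    using \<alpha> by (intro mult_left_mono) (simp_all only: avg_linear avg_s_centred avg_s_shifted_modulus avg_sigma avg_W less_imp_le)
  then show ?thesis by (simp add: avg_linear mult.assoc) (simp add: algebra_simps)
qed

lemma avg_descent: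
  assumes "\<alpha> \<le> 1 / 4"
  shows "avg (\<lambda>i. (norm (x - (\<alpha> * s i) *\<^sub>R g i x - xs))\<^sup>2)
    \<le> (1 - \<rho>) * (norm (x - xs))\<^sup>2 - 1 / 2 * (\<alpha> * \<gamma>\<^sup>2 * W x)
      + 3 * \<alpha> / 2 * (4 * \<alpha> + 1) * \<gamma>\<^sup>2 * \<sigma>2"
proof -
  have "avg (\<lambda>i. \<alpha> * ((s i)\<^sup>2 * (norm (g i x))\<^sup>2) - 2 * (s i * ((g i x - F i xs) \<bullet> (x - xs))))
    \<le> avg (\<lambda>i. - 2 * (s i * shifted_modulus (\<mu> i) * (norm (x - xs))\<^sup>2)
     - 1/2 * ((s i)\<^sup>2 * ((1 - 4 * \<bar>\<mu> i\<bar> * s i - 2 * (s i * L i)\<^sup>2) * (norm (F i x))\<^sup>2))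
     + (6 * \<alpha> + 3/2) * ((s i)\<^sup>2 * (norm (F i xs))\<^sup>2))"
    using extragradient_sample.sample_descent[OF sample, of _ \<alpha>] \<alpha> assms
    by (intro avg_mono) (simp add: seg_direction_def)
  then have "avg (\<lambda>i. \<alpha> * ((s i)\<^sup>2 * (norm (g i x))\<^sup>2)) - 2 * avg (\<lambda>i. s i * (g i x \<bullet> (x - xs)))
     \<le> - 2 * (\<gamma> * mu_bar n \<mu> / 2 * (norm (x - xs))\<^sup>2) - 1/2 * (\<gamma>\<^sup>2 * W x) + (6 * \<alpha> + 3/2) * (\<gamma>\<^sup>2 * \<sigma>2)"
    by (simp only: avg_linear avg_s_centred avg_s_shifted_modulus avg_sigma avg_W)
  moreover have "0 \<le> \<gamma> * mu_bar n \<mu> / 2 * (norm (x - xs))\<^sup>2"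
    using mu_bar_nonneg \<gamma>(1) by simp
  ultimately have "avg (\<lambda>i. \<alpha> * ((s i)\<^sup>2 * (norm (g i x))\<^sup>2)) - 2 * avg (\<lambda>i. s i * (g i x \<bullet> (x - xs)))
     \<le> - (\<gamma> * mu_bar n \<mu> / 2 * (norm (x - xs))\<^sup>2) - 1/2 * (\<gamma>\<^sup>2 * W x) + (6 * \<alpha> + 3/2) * (\<gamma>\<^sup>2 * \<sigma>2)"
    by linarith
  from mult_left_mono[OF this less_imp_le[OF \<alpha>(1)]]
  have step: "\<alpha> * (avg (\<lambda>i. \<alpha> * ((s i)\<^sup>2 * (norm (g i x))\<^sup>2)) - 2 * avg (\<lambda>i. s i * (g i x \<bullet> (x - xs))))
     \<le> - \<rho> * (norm (x - xs))\<^sup>2 - 1/2 * (\<alpha> * \<gamma>\<^sup>2 * W x) + 3 * \<alpha> / 2 * (4 * \<alpha> + 1) * \<gamma>\<^sup>2 * \<sigma>2"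
    by (simp add: algebra_simps)
  have expand: "(norm (x - (\<alpha> * s i) *\<^sub>R g i x - xs))\<^sup>2 = (norm (x - xs))\<^sup>2
      + \<alpha> * (\<alpha> * ((s i)\<^sup>2 * (norm (g i x))\<^sup>2) - 2 * (s i * (g i x \<bullet> (x - xs))))" for i
  proof -
    have "(norm (x - (\<alpha> * s i) *\<^sub>R g i x - xs))\<^sup>2 = (norm ((x - xs) - (\<alpha> * s i) *\<^sub>R g i x))\<^sup>2"
      by (simp add: algebra_simps)
    also have "\<dots> = (norm (x - xs))\<^sup>2 + (norm ((\<alpha> * s i) *\<^sub>R g i x))\<^sup>2 - 2 * ((x - xs) \<bullet> ((\<alpha> * s i) *\<^sub>R g i x))"
      by (rule power2_norm_eq_inner[THEN trans])
         (simp only: power2_norm_eq_inner inner_diff_left inner_diff_right inner_commute, simp)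
    finally show ?thesis
      by (simp add: power_mult_distrib inner_commute power2_eq_square algebra_simps)
  qed
  show ?thesis using step unfolding expand avg_linear avg_const by (simp only: left_diff_distrib)
qed

lemma W_nonneg: "0 \<le> W x"
proof -
  have "0 \<le> 1 - 4 * (\<bar>\<mu> i\<bar> / L i) * Lbar * \<gamma> - 2 * Lbar\<^sup>2 * \<gamma>\<^sup>2" if i: "i \<in> {1..n}" for i
  proof -
    have t: "0 \<le> Lbar * \<gamma>" "Lbar * \<gamma> \<le> 1/6"
      using s_facts(2,3)[OF i] Lbar_pos \<gamma>(1) by (auto simp: mult.commute)
    have "\<bar>\<mu> i\<bar> / L i * (Lbar * \<gamma>) \<le> 1 * (1/6)"
      using mu_le[OF i] L_pos[OF i] t by (intro mult_mono) auto
    moreover have "(Lbar * \<gamma>)\<^sup>2 \<le> (1/6)\<^sup>2" using t by (intro power_mono) auto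
    ultimately have "0 \<le> 1 - 4 * (\<bar>\<mu> i\<bar> / L i * (Lbar * \<gamma>)) - 2 * (Lbar * \<gamma>)\<^sup>2"
      by (simp only: power2_eq_square)
    then show ?thesis by (simp add: power_mult_distrib mult.assoc)
  qed
  then show ?thesis unfolding weighted_residual_def
    using Lbar_pos L_pos by (intro mult_nonneg_nonneg sum_nonneg divide_nonneg_nonneg) (auto simp: less_imp_le)
qed

lemma sigma_nonneg: "0 \<le> \<sigma>2"
  unfolding sigma_IS_sq_def
  using Lbar_pos L_pos by (intro mult_nonneg_nonneg sum_nonneg divide_nonneg_nonneg) (auto simp: less_imp_le)

lemma rho_bounds: "0 \<le> \<rho>" "\<rho> \<le> 1"
proof -
  show "0 \<le> \<rho>" using \<alpha> \<gamma> mu_bar_nonneg by simp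
  have "(\<Sum>i | i \<in> {1..n} \<and> \<mu> i \<ge> 0. \<mu> i) \<le> (\<Sum>i | i \<in> {1..n} \<and> \<mu> i \<ge> 0. L i)"
    using mu_le by (intro sum_mono) (auto simp: abs_le_iff)
  also have "\<dots> \<le> (\<Sum>i=1..n. L i)"
    using L_pos by (intro sum_mono2) (auto simp: less_imp_le)
  finally have 1: "(1 / real n) * (\<Sum>i | i \<in> {1..n} \<and> \<mu> i \<ge> 0. \<mu> i) \<le> Lbar"
    unfolding mean_real_def by (intro mult_left_mono) auto
  have "(\<Sum>i | i \<in> {1..n} \<and> \<mu> i < 0. \<mu> i) \<le> 0" by (intro sum_nonpos) auto
  then have "(4 / real n) * (\<Sum>i | i \<in> {1..n} \<and> \<mu> i < 0. \<mu> i) \<le> 0"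
    by (intro mult_nonneg_nonpos) auto
  with 1 have "mu_bar n \<mu> \<le> Lbar" by (simp add: mu_bar_def)
  then have "\<gamma> * mu_bar n \<mu> \<le> \<gamma> * Lbar" using \<gamma>(1) by simp
  also have "\<dots> \<le> 1/6" using s_facts(2,3)[of 1] n by simp
  finally have "\<alpha> * (\<gamma> * mu_bar n \<mu>) \<le> 1 * (1/6)" using \<alpha> \<gamma>(1) mu_bar_nonneg by (intro mult_mono) auto
  then show "\<rho> \<le> 1" by simp
qed

end

section \<open>Expected progress of the method\<close>

lemma linear_recursion_bound:
  fixes e :: "nat \<Rightarrow> real"
  assumes "\<And>k. e (Suc k) \<le> (1 - r) * e k + D" "0 < r" "r \<le> 1" "0 \<le> D"
  shows "e k \<le> (1 - r) ^ k * e 0 + D / r"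
proof (induction k)
  case (Suc k)
  have "e (Suc k) \<le> (1 - r) * e k + D" by fact
  also have "\<dots> \<le> (1 - r) * ((1 - r) ^ k * e 0 + D / r) + D"
    using Suc assms(3) by (intro add_right_mono mult_left_mono) auto
  also have "\<dots> = (1 - r) ^ Suc k * e 0 + D / r" using assms(2) by (simp add: field_simps)
  finally show ?case .
qed (use assms in simp)

lemma telescoped_recursion_bound:
  fixes e w :: "nat \<Rightarrow> real"
  assumes "\<And>k. e (Suc k) \<le> e k - w k + D"
  shows "(\<Sum>k=0..K. w k) + e (Suc K) \<le> e 0 + (real K + 1) * D"
proof (induction K)
  case (Suc K)
  then show ?case using assms[of "Suc K"] by (simp add: algebra_simps)
qed (use assms[of 0] in simp)

locale importance_sampled_seg_process = importance_sampled_seg n F L \<mu> \<gamma> \<alpha> xs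
  for n :: nat and F :: "nat \<Rightarrow> 'a::euclidean_space \<Rightarrow> 'a" and L \<mu> :: "nat \<Rightarrow> real"
    and \<gamma> \<alpha> :: real and xs :: 'a +
  fixes x0 :: 'a and M :: "'s measure" and \<xi> :: "nat \<Rightarrow> 's \<Rightarrow> nat"
  assumes M: "prob_space M"
    and \<xi>_indep: "prob_space.indep_vars M (\<lambda>_. count_space {1..n}) \<xi> UNIV"
    and \<xi>_dist: "\<And>k i. i \<in> {1..n} \<Longrightarrow>
           measure M {\<omega> \<in> space M. \<xi> k \<omega> = i} = L i / (\<Sum>j=1..n. L j)"
begin

interpretation prob_space M by (rule M)

definition X :: "nat \<Rightarrow> 's \<Rightarrow> 'a" where
  "X k \<omega> = s_seg F s (\<lambda>i. \<alpha> * s i) x0 (\<lambda>j. \<xi> j \<omega>) k"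

lemma X_0: "X 0 \<omega> = x0"
  and X_Suc: "X (Suc k) \<omega> = X k \<omega> - (\<alpha> * s (\<xi> k \<omega>)) *\<^sub>R g (\<xi> k \<omega>) (X k \<omega>)"
  by (simp_all add: X_def)

lemma F_cont: "i \<in> {1..n} \<Longrightarrow> continuous_on UNIV (F i)"
  using F_lip lipschitz_on_continuous_on by blast

lemma F_meas [measurable]: "i \<in> {1..n} \<Longrightarrow> F i \<in> borel_measurable borel"
  using F_cont by (simp add: borel_measurable_continuous_onI)

lemma g_meas [measurable]: "i \<in> {1..n} \<Longrightarrow> g i \<in> borel_measurable borel"
  unfolding seg_direction_def by measurable

lemma \<xi>_meas: "\<xi> k \<in> measurable M (count_space {1..n})"
  using \<xi>_indep by (simp add: indep_vars_def)

lemma X_meas [measurable]: "X k \<in> borel_measurable M"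
  unfolding X_def by (intro measurable_s_seg[where I="{1..n}"] F_cont \<xi>_meas) auto

lemma integrable_X:
  fixes u :: "'a \<Rightarrow> real"
  assumes "u \<in> borel_measurable borel"
  shows "integrable M (\<lambda>\<omega>. u (X k \<omega>))"
proof -
  have fin: "finite (X k ` space M)"
    unfolding X_def using measurable_space[OF \<xi>_meas] by (intro finite_range_s_seg[of "{1..n}"]) auto
  show ?thesis
  proof (rule integrable_const_bound)
    show "AE \<omega> in M. norm (u (X k \<omega>)) \<le> Max ((\<lambda>y. norm (u y)) ` X k ` space M)"
      using fin by (intro AE_I2 Max_ge) auto
    show "(\<lambda>\<omega>. u (X k \<omega>)) \<in> borel_measurable M"
      by (rule measurable_compose[OF X_meas assms])
  qed
qed

lemma fresh_sample:
  assumes "\<forall>i\<in>{1..n}. h i \<in> borel_measurable borel"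
  shows "integrable M (\<lambda>\<omega>. h (\<xi> k \<omega>) (X k \<omega>))"
    and "AE \<omega> in M. cond_exp_given M (X k) (\<lambda>\<omega>. h (\<xi> k \<omega>) (X k \<omega>)) \<omega> = avg (\<lambda>i. h i (X k \<omega>))"
    and "(\<integral>\<omega>. h (\<xi> k \<omega>) (X k \<omega>) \<partial>M) = (\<integral>\<omega>. avg (\<lambda>i. h i (X k \<omega>)) \<partial>M)"
    and "integrable M (\<lambda>\<omega>. avg (\<lambda>i. h i (X k \<omega>)))"
proof -
  have ind: "\<forall>i\<in>{1..n}. \<forall>u\<in>borel_measurable borel.
      indep_var borel (\<lambda>\<omega>. indicator {i} (\<xi> k \<omega>) :: real) borel (\<lambda>\<omega>. u (X k \<omega>))"
    unfolding X_def using F_cont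
    by (intro ballI indep_var_sample_iterate[OF M \<xi>_indep]) auto
  have int: "\<forall>i\<in>{1..n}. integrable M (\<lambda>\<omega>. h i (X k \<omega>))"
    using assms integrable_X by blast
  have E: "(\<Sum>i=1..n. measure M {\<omega> \<in> space M. \<xi> k \<omega> = i} * h i y) = avg (\<lambda>i. h i y)" for y
    unfolding avg_def by (intro sum.cong refl) (simp only: \<xi>_dist)
  note main = cond_exp_independent_sample[where h = h and X = "X k" and Z = "\<xi> k" and I = "{1..n}",
      OF M finite_atLeastAtMost X_meas \<xi>_meas ind assms int, unfolded E]
  show "integrable M (\<lambda>\<omega>. h (\<xi> k \<omega>) (X k \<omega>))"
    and "AE \<omega> in M. cond_exp_given M (X k) (\<lambda>\<omega>. h (\<xi> k \<omega>) (X k \<omega>)) \<omega> = avg (\<lambda>i. h i (X k \<omega>))"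
    and "(\<integral>\<omega>. h (\<xi> k \<omega>) (X k \<omega>) \<partial>M) = (\<integral>\<omega>. avg (\<lambda>i. h i (X k \<omega>)) \<partial>M)"
    and "integrable M (\<lambda>\<omega>. avg (\<lambda>i. h i (X k \<omega>)))"
    by (rule main)+
qed

lemma W_meas [measurable]: "W \<in> borel_measurable borel"
  unfolding weighted_residual_def[abs_def] by measurable

lemma unified:
  "unified_assumption M xs X (\<lambda>k \<omega>. \<alpha> * s (\<xi> k \<omega>)) (\<lambda>k \<omega>. g (\<xi> k \<omega>) (X k \<omega>))
     (2 * \<alpha>) (1 / 2) 0 (6 * \<alpha>\<^sup>2 * \<gamma>\<^sup>2 * \<sigma>2) (3 * \<alpha> * \<gamma>\<^sup>2 / 2 * \<sigma>2) \<rho>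
     (\<lambda>k \<omega>. \<alpha> * \<gamma>\<^sup>2 * W (X k \<omega>))"
proof -
  let ?q = "\<lambda>i y. (\<alpha> * s i)\<^sup>2 * (norm (g i y))\<^sup>2" and ?p = "\<lambda>i y. \<alpha> * s i * (g i y \<bullet> (y - xs))"
  have q: "\<forall>i\<in>{1..n}. ?q i \<in> borel_measurable borel"
    and p: "\<forall>i\<in>{1..n}. ?p i \<in> borel_measurable borel"
    by measurable
  have "AE \<omega> in M. cond_exp_given M (X k) (\<lambda>\<omega>. ?q (\<xi> k \<omega>) (X k \<omega>)) \<omega>
          \<le> 2 * (2 * \<alpha>) * cond_exp_given M (X k) (\<lambda>\<omega>. ?p (\<xi> k \<omega>) (X k \<omega>)) \<omega>
             + 0 * (norm (X k \<omega> - xs))\<^sup>2 + 6 * \<alpha>\<^sup>2 * \<gamma>\<^sup>2 * \<sigma>2 \<and>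
        cond_exp_given M (X k) (\<lambda>\<omega>. ?p (\<xi> k \<omega>) (X k \<omega>)) \<omega> \<ge>
          \<rho> * (norm (X k \<omega> - xs))\<^sup>2 + 1 / 2 * (\<alpha> * \<gamma>\<^sup>2 * W (X k \<omega>)) - 3 * \<alpha> * \<gamma>\<^sup>2 / 2 * \<sigma>2" for k
    using fresh_sample(2)[where h = ?q, OF q, of k] fresh_sample(2)[where h = ?p, OF p, of k]
  proof eventually_elim
    case (elim \<omega>)
    have "2 * (2 * \<alpha>) = 4 * \<alpha>" by simp
    then show ?case
      unfolding elim using avg_second_moment[of "X k \<omega>"] avg_progress[of "X k \<omega>"]
      by (simp only: mult_zero_left add_0_right simp_thms)
  qed
  moreover have "0 \<le> 6 * \<alpha>\<^sup>2 * \<gamma>\<^sup>2 * \<sigma>2" "0 \<le> 3 * \<alpha> * \<gamma>\<^sup>2 / 2 * \<sigma>2" "0 \<le> \<alpha> * \<gamma>\<^sup>2 * W y" for y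
    using \<alpha> sigma_nonneg W_nonneg[of y] by simp_all
  ultimately show ?thesis
    unfolding unified_assumption_def Let_def
    using \<alpha> rho_bounds fresh_sample(1)[where h = ?q, OF q] fresh_sample(1)[where h = ?p, OF p]
    by (intro conjI allI ballI X_meas X_Suc) simp_all
qed

lemma expected_descent:
  assumes "\<alpha> \<le> 1 / 4"
  shows "(\<integral>\<omega>. (norm (X (Suc k) \<omega> - xs))\<^sup>2 \<partial>M)
    \<le> (1 - \<rho>) * (\<integral>\<omega>. (norm (X k \<omega> - xs))\<^sup>2 \<partial>M) - \<alpha> * \<gamma>\<^sup>2 / 2 * (\<integral>\<omega>. W (X k \<omega>) \<partial>M)
      + 3 * \<alpha> / 2 * (4 * \<alpha> + 1) * \<gamma>\<^sup>2 * \<sigma>2"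
proof -
  let ?h = "\<lambda>i y. (norm (y - (\<alpha> * s i) *\<^sub>R g i y - xs))\<^sup>2"
  have h: "\<forall>i\<in>{1..n}. ?h i \<in> borel_measurable borel"
    by measurable
  have int: "integrable M (\<lambda>\<omega>. (norm (X k \<omega> - xs))\<^sup>2)" "integrable M (\<lambda>\<omega>. W (X k \<omega>))"
    using integrable_X[of "\<lambda>y. (norm (y - xs))\<^sup>2" k] integrable_X[OF W_meas] by auto
  have "(\<integral>\<omega>. (norm (X (Suc k) \<omega> - xs))\<^sup>2 \<partial>M) = (\<integral>\<omega>. avg (\<lambda>i. ?h i (X k \<omega>)) \<partial>M)"
    unfolding X_Suc by (rule fresh_sample(3)[where h = ?h, OF h])
  also have "\<dots> \<le> (\<integral>\<omega>. (1 - \<rho>) * (norm (X k \<omega> - xs))\<^sup>2 - 1 / 2 * (\<alpha> * \<gamma>\<^sup>2 * W (X k \<omega>))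
      + 3 * \<alpha> / 2 * (4 * \<alpha> + 1) * \<gamma>\<^sup>2 * \<sigma>2 \<partial>M)"
    using int fresh_sample(4)[where h = ?h, OF h, of k] avg_descent[OF assms] by (intro integral_mono) auto
  also have "\<dots> = (1 - \<rho>) * (\<integral>\<omega>. (norm (X k \<omega> - xs))\<^sup>2 \<partial>M) - \<alpha> * \<gamma>\<^sup>2 / 2 * (\<integral>\<omega>. W (X k \<omega>) \<partial>M)
      + 3 * \<alpha> / 2 * (4 * \<alpha> + 1) * \<gamma>\<^sup>2 * \<sigma>2"
    using int by (simp add: prob_space)
  finally show ?thesis .
qed

lemma expected_contraction:
  assumes "\<alpha> \<le> 1 / 4"
  shows "(\<integral>\<omega>. (norm (X (Suc k) \<omega> - xs))\<^sup>2 \<partial>M)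
    \<le> (1 - \<rho>) * (\<integral>\<omega>. (norm (X k \<omega> - xs))\<^sup>2 \<partial>M) + 3 * \<alpha> / 2 * (4 * \<alpha> + 1) * \<gamma>\<^sup>2 * \<sigma>2"
proof -
  have "0 \<le> \<alpha> * \<gamma>\<^sup>2 / 2 * (\<integral>\<omega>. W (X k \<omega>) \<partial>M)"
    using \<alpha> by (intro mult_nonneg_nonneg integral_nonneg_AE) (auto simp: W_nonneg)
  then show ?thesis using expected_descent[OF assms, of k] by linarith
qed

lemma expected_distance_bound:
  assumes "\<alpha> \<le> 1 / 4" "mu_bar n \<mu> > 0"
  shows "(\<integral>\<omega>. (norm (X k \<omega> - xs))\<^sup>2 \<partial>M)
    \<le> (1 - \<rho>) ^ k * (norm (x0 - xs))\<^sup>2 + 3 * (4 * \<alpha> + 1) * \<gamma> * \<sigma>2 / mu_bar n \<mu>"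
proof -
  let ?D = "3 * \<alpha> / 2 * (4 * \<alpha> + 1) * \<gamma>\<^sup>2 * \<sigma>2"
  have "0 < \<rho>" "0 \<le> ?D" using assms \<alpha> \<gamma> sigma_nonneg by auto
  from linear_recursion_bound[of "\<lambda>k. \<integral>\<omega>. (norm (X k \<omega> - xs))\<^sup>2 \<partial>M", OF expected_contraction[OF assms(1)] this(1) rho_bounds(2) this(2), of k]
  have "(\<integral>\<omega>. (norm (X k \<omega> - xs))\<^sup>2 \<partial>M) \<le> (1 - \<rho>) ^ k * (norm (x0 - xs))\<^sup>2 + ?D / \<rho>"
    by (simp add: X_0 prob_space)
  also have "?D / \<rho> = 3 * (4 * \<alpha> + 1) * \<gamma> * \<sigma>2 / mu_bar n \<mu>"
    using assms \<alpha> \<gamma>(1) by (simp add: field_simps power2_eq_square)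
  finally show ?thesis .
qed

lemma expected_residual_bound:
  assumes "\<alpha> \<le> 1 / 4" "mu_bar n \<mu> = 0"
  shows "1 / (real K + 1) * (\<Sum>k=0..K. \<integral>\<omega>. W (X k \<omega>) \<partial>M)
    \<le> 2 * (norm (x0 - xs))\<^sup>2 / (\<alpha> * \<gamma>\<^sup>2 * (real K + 1)) + 3 * (4 * \<alpha> + 1) * \<sigma>2"
proof -
  define c where "c = \<alpha> * \<gamma>\<^sup>2 / 2"
  let ?S = "\<Sum>k=0..K. \<integral>\<omega>. W (X k \<omega>) \<partial>M"
  have c: "c > 0" using \<alpha> \<gamma>(1) by (simp add: c_def)
  have "(\<integral>\<omega>. (norm (X (Suc k) \<omega> - xs))\<^sup>2 \<partial>M) \<le> (\<integral>\<omega>. (norm (X k \<omega> - xs))\<^sup>2 \<partial>M)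
      - c * (\<integral>\<omega>. W (X k \<omega>) \<partial>M) + c * (3 * (4 * \<alpha> + 1) * \<sigma>2)" for k
    using expected_descent[OF assms(1), of k] assms(2)
    by (simp add: c_def algebra_simps add_divide_distrib)
  from telescoped_recursion_bound[of "\<lambda>k. \<integral>\<omega>. (norm (X k \<omega> - xs))\<^sup>2 \<partial>M"
      "\<lambda>k. c * (\<integral>\<omega>. W (X k \<omega>) \<partial>M)", OF this, of K]
  have "c * ?S + (\<integral>\<omega>. (norm (X (Suc K) \<omega> - xs))\<^sup>2 \<partial>M)
      \<le> (norm (x0 - xs))\<^sup>2 + (real K + 1) * (c * (3 * (4 * \<alpha> + 1) * \<sigma>2))"
    by (simp add: X_0 prob_space sum_distrib_left)
  moreover have "0 \<le> (\<integral>\<omega>. (norm (X (Suc K) \<omega> - xs))\<^sup>2 \<partial>M)" by simp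
  ultimately have "c * ?S \<le> (norm (x0 - xs))\<^sup>2 + (real K + 1) * (c * (3 * (4 * \<alpha> + 1) * \<sigma>2))"
    by linarith
  then have "c * ?S / (c * (real K + 1)) \<le>
      ((norm (x0 - xs))\<^sup>2 + (real K + 1) * (c * (3 * (4 * \<alpha> + 1) * \<sigma>2))) / (c * (real K + 1))"
    using c by (intro divide_right_mono) auto
  also have "\<dots> = (norm (x0 - xs))\<^sup>2 / (c * (real K + 1)) + 3 * (4 * \<alpha> + 1) * \<sigma>2"
  proof -
    have "c * (real K + 1) \<noteq> 0" using c by simp
    moreover have "(real K + 1) * (c * (3 * (4 * \<alpha> + 1) * \<sigma>2)) = (3 * (4 * \<alpha> + 1) * \<sigma>2) * (c * (real K + 1))"
      by (simp only: mult_ac)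
    ultimately show ?thesis by (metis add_divide_distrib nonzero_mult_div_cancel_right)
  qed
  finally have "c * ?S / (c * (real K + 1))
      \<le> (norm (x0 - xs))\<^sup>2 / (c * (real K + 1)) + 3 * (4 * \<alpha> + 1) * \<sigma>2" .
  moreover have "c * ?S / (c * (real K + 1)) = 1 / (real K + 1) * ?S" using c by simp
  moreover have "(norm (x0 - xs))\<^sup>2 / (c * (real K + 1))
      = 2 * (norm (x0 - xs))\<^sup>2 / (\<alpha> * \<gamma>\<^sup>2 * (real K + 1))"
    by (simp add: c_def)
  ultimately show ?thesis by (simp only:)
qed

end

theorem theoremE4:
  fixes n :: nat
    and F :: "nat \<Rightarrow> real ^ 'd \<Rightarrow> real ^ 'd"
    and L \<mu> \<gamma>1 \<gamma>2 :: "nat \<Rightarrow> real"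
    and xs x0 :: "real ^ 'd"
    and \<gamma> \<alpha> Lbar mubar \<sigma>2 :: real
    and M :: "'s measure"
    and \<xi> :: "nat \<Rightarrow> 's \<Rightarrow> nat"
    and x g :: "nat \<Rightarrow> 's \<Rightarrow> real ^ 'd"
  defines "Lbar \<equiv> mean_real n L"
    and "mubar \<equiv> mu_bar n \<mu>"
    and "\<sigma>2 \<equiv> sigma_IS_sq n F L xs"
    and "\<gamma>1 \<equiv> \<lambda>i. \<gamma> * Lbar / L i"
    and "\<gamma>2 \<equiv> \<lambda>i. \<alpha> * \<gamma>1 i"
    and "x \<equiv> \<lambda>k \<omega>. s_seg F \<gamma>1 \<gamma>2 x0 (\<lambda>j. \<xi> j \<omega>) k"
    and "g \<equiv> \<lambda>k \<omega>. seg_direction F \<gamma>1 (\<xi> k \<omega>) (x k \<omega>)"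
  assumes "n \<ge> 1"
    and "\<And>i. i \<in> {1..n} \<Longrightarrow> L i > 0"
    and "\<And>i. i \<in> {1..n} \<Longrightarrow> (L i)-lipschitz_on UNIV (F i)"
    and "\<And>i y. i \<in> {1..n} \<Longrightarrow> (F i y - F i xs) \<bullet> (y - xs) \<ge> \<mu> i * (norm (y - xs))\<^sup>2"
    and "\<And>i. i \<in> {1..n} \<Longrightarrow> \<bar>\<mu> i\<bar> \<le> L i"
    and "mean_operator n F xs = 0"
    and "mubar \<ge> 0"
    and "prob_space M"
    and "prob_space.indep_vars M (\<lambda>_. count_space {1..n}) \<xi> UNIV"
    and "\<And>k i. i \<in> {1..n} \<Longrightarrow>
           measure M {\<omega> \<in> space M. \<xi> k \<omega> = i} = L i / (\<Sum>j=1..n. L j)"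
    and "0 < \<gamma>" and "\<gamma> \<le> 1 / (6 * Lbar)"
    and "0 < \<alpha>" and "\<alpha> < 1"
  shows "unified_assumption M xs x (\<lambda>k \<omega>. \<gamma>2 (\<xi> k \<omega>)) g
           (2 * \<alpha>) (1 / 2) 0 (6 * \<alpha>\<^sup>2 * \<gamma>\<^sup>2 * \<sigma>2) (3 * \<alpha> * \<gamma>\<^sup>2 / 2 * \<sigma>2) (\<alpha> * \<gamma> * mubar / 2)
           (\<lambda>k \<omega>. \<alpha> * \<gamma>\<^sup>2 * weighted_residual n F L \<mu> \<gamma> (x k \<omega>)) \<and>
         (\<alpha> \<le> 1 / 4 \<longrightarrow>
           (mubar > 0 \<longrightarrow> (\<forall>K.
             (\<integral>\<omega>. (norm (x (K + 1) \<omega> - xs))\<^sup>2 \<partial>M)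
             \<le> (1 - \<alpha> * \<gamma> * mubar / 2) * (\<integral>\<omega>. (norm (x K \<omega> - xs))\<^sup>2 \<partial>M)
               + 3 * \<alpha> / 2 * (4 * \<alpha> + 1) * \<gamma>\<^sup>2 * \<sigma>2)) \<and>
           (mubar > 0 \<longrightarrow> (\<forall>K.
             (\<integral>\<omega>. (norm (x K \<omega> - xs))\<^sup>2 \<partial>M)
             \<le> (1 - \<alpha> * \<gamma> * mubar / 2) ^ K * (norm (x0 - xs))\<^sup>2
               + 3 * (4 * \<alpha> + 1) * \<gamma> * \<sigma>2 / mubar)) \<and>
           (mubar = 0 \<longrightarrow> (\<forall>K.
             1 / (real K + 1) * (\<Sum>k=0..K. \<integral>\<omega>. weighted_residual n F L \<mu> \<gamma> (x k \<omega>) \<partial>M)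
             \<le> 2 * (norm (x0 - xs))\<^sup>2 / (\<alpha> * \<gamma>\<^sup>2 * (real K + 1)) + 3 * (4 * \<alpha> + 1) * \<sigma>2)))"
proof -
  interpret importance_sampled_seg_process n F L \<mu> \<gamma> \<alpha> xs x0 M \<xi>

    by (intro importance_sampled_seg_process.intro importance_sampled_seg.intro
        importance_sampled_seg_process_axioms.intro) (fact assms[unfolded Lbar_def mubar_def])+
  have s: "s = \<gamma>1" by (auto simp: s_def \<gamma>1_def Lbar_def)
  have x: "x = X" by (simp add: fun_eq_iff x_def X_def s \<gamma>2_def)
  have g: "g = (\<lambda>k \<omega>. seg_direction F s (\<xi> k \<omega>) (X k \<omega>))" by (simp add: g_def s x)
  have \<gamma>2: "\<gamma>2 = (\<lambda>i. \<alpha> * s i)" by (simp add: \<gamma>2_def s)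
  show ?thesis
    unfolding x g \<gamma>2 mubar_def \<sigma>2_def
    using unified expected_contraction expected_distance_bound expected_residual_bound by simp
qed

end
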